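(* Let $m\ge 1$ be an integer, let $G$ be a doubly regular tournament with $v=4m-1$ vertices, and let $\Gamma$ be a transitive subtournament of size $s$ in $G$. Let $\epsilon:=\sqrt{1+12m}-\lfloor\sqrt{1+12m}\rfloor$. Then the following hold. (1) $s\le -1+\lfloor\sqrt{1+12m}\rfloor$. (2) $s\le -2+\sqrt{1+12m}$ if $\epsilon=0$. (3) $s\le -2+\lfloor\sqrt{1+12m}\rfloor$ if $\epsilon\neq 0$ and $-1+\lfloor\sqrt{1+12m}\rfloor$ is odd. (4) $s\le -2+\lfloor\sqrt{1+12m}\rfloor$ if $\epsilon\neq 0$ and $\lfloor\sqrt{1+12m}\rfloor>(-1+\sqrt{1+48m})/2$.
   Context: A tournament is a finite digraph $G=(V,E)$ such that for any two distinct vertices $x,y$ exactly one of $(x,y)\in E$, $(y,x)\in E$ holds, and $(x,x)\notin E$ for all $x$. A vertex $x$ dominates $y$ if $(x,y)\in E$. A tournament with $v$ vertices is doubly regular if every vertex has in-degree and out-degree $(v-1)/2$ and the number of vertices dominated simultaneously by both vertices of a pair of two distinct vertices is a constant not depending on the choice of the pair (this constant is then $(v-3)/4$). A transitive tournament is a tournament such that $(x,y)\in E$ and $(y,z)\in E$ imply $(x,z)\in E$. A transitive subtournament of size $s$ in $G$ is an induced sub-digraph of $G$ on $s$ vertices which is a transitive tournament. *)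

theory Defs
  imports Complex_Main "Graph_Theory.Graph_Theory"
begin

text \<open>Finiteness, loop-freeness and well-formedness come from \<^locale>\<open>pair_digraph\<close>; a vertex
  \<open>x\<close> dominates \<open>y\<close> iff \<open>(x, y) \<in> parcs G\<close>.\<close>

locale tournament = pair_digraph G for G :: "'a pair_pre_digraph" +
  assumes exactly_one_arc:
    "x \<in> pverts G \<Longrightarrow> y \<in> pverts G \<Longrightarrow> x \<noteq> y \<Longrightarrow>
      (x, y) \<in> parcs G \<longleftrightarrow> (y, x) \<notin> parcs G"

text \<open>The degree conditions are equations between reals, so that no halves are rounded.\<close>

locale doubly_regular_tournament = tournament +
  assumes in_degree_eq:
    "x \<in> pverts G \<Longrightarrow> real (in_degree (with_proj G) x) = (real (card (pverts G)) - 1) / 2"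
  and out_degree_eq:
    "x \<in> pverts G \<Longrightarrow> real (out_degree (with_proj G) x) = (real (card (pverts G)) - 1) / 2"
  and common_dominated_const:
    "\<exists>c. \<forall>x\<in>pverts G. \<forall>y\<in>pverts G. x \<noteq> y \<longrightarrow>
      card {z \<in> pverts G. (x, z) \<in> parcs G \<and> (y, z) \<in> parcs G} = c"

locale transitive_tournament = tournament +
  assumes trans_arcs: "trans (parcs G)"

definition transitive_subtournament :: "'a pair_pre_digraph \<Rightarrow> 'a pair_pre_digraph \<Rightarrow> bool" where
  "transitive_subtournament H G \<longleftrightarrow>
     induced_subgraph (with_proj H) (with_proj G) \<and> transitive_tournament H"

end

theory Submission
  imports Defs
begin

text \<open>Let \<open>\<sigma>\<close> be the skew adjacency matrix of \<open>G\<close>. Double regularity says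
  \<open>\<sigma> \<sigma>\<^sup>T = v I - J\<close>, so the squared column sums of the submatrix formed by the
  rows indexed by \<open>\<Gamma>\<close> add up to \<open>s (v - s)\<close>. The columns in \<open>\<Gamma>\<close> contribute exactly \<open>(s\<^sup>3 - s) / 3\<close>, since \<open>\<Gamma>\<close> is transitive.
  The other \<open>v - s\<close> columns contribute at least \<open>0\<close>, and at least \<open>v - s\<close> if \<open>s\<close> is odd, since
  their sums are then odd. This gives \<open>(s + 1) (s + 2) \<le> 12 m\<close>, and \<open>(s + 1) (s + 3) \<le> 12 m\<close> if
  \<open>s\<close> is odd and greater than \<open>1\<close>.\<close>

section \<open>The skew adjacency matrix of a tournament\<close>

definition arc_sign :: "'a pair_pre_digraph \<Rightarrow> 'a \<Rightarrow> 'a \<Rightarrow> int" where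
  "arc_sign G x y = of_bool ((x, y) \<in> parcs G) - of_bool ((y, x) \<in> parcs G)"

context tournament
begin

lemma arc_in_verts:
  assumes "(x, y) \<in> parcs G"
  shows "x \<in> pverts G" "y \<in> pverts G" "x \<noteq> y"
  using assms wellformed[of "(x, y)"] no_loops[of "(x, y)"] by auto

lemma arc_sign_eq:
  assumes "x \<in> pverts G" "y \<in> pverts G"
  shows "arc_sign G x y = 2 * of_bool ((x, y) \<in> parcs G) - 1 + of_bool (x = y)"
  using assms exactly_one_arc[of x y] arc_in_verts(3)[of x x] by (auto simp: arc_sign_def)

lemma odd_arc_sign:
  assumes "x \<in> pverts G" "y \<in> pverts G" "x \<noteq> y"
  shows "odd (arc_sign G x y)"
  using assms by (simp add: arc_sign_eq)

lemma out_degree_eq_sum: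
  "int (out_degree (with_proj G) x) = (\<Sum>z\<in>pverts G. of_bool ((x, z) \<in> parcs G))"
proof -
  have "out_arcs (with_proj G) x = Pair x ` {z \<in> pverts G. (x, z) \<in> parcs G}"
    by (auto simp: out_arcs_def dest: arc_in_verts)
  then have "out_degree (with_proj G) x = card {z \<in> pverts G. (x, z) \<in> parcs G}"
    by (simp add: out_degree_def card_image inj_on_def)
  then show ?thesis
    by (simp add: Int_def)
qed

lemma in_degree_eq_sum:
  "int (in_degree (with_proj G) x) = (\<Sum>z\<in>pverts G. of_bool ((z, x) \<in> parcs G))"
proof -
  have "in_arcs (with_proj G) x = (\<lambda>z. (z, x)) ` {z \<in> pverts G. (z, x) \<in> parcs G}"
    by (auto simp: in_arcs_def dest: arc_in_verts)
  then have "in_degree (with_proj G) x = card {z \<in> pverts G. (z, x) \<in> parcs G}"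
    by (simp add: in_degree_def card_image inj_on_def)
  then show ?thesis
    by (simp add: Int_def)
qed

end

section \<open>Column sums of a transitive tournament\<close>

context transitive_tournament
begin

text \<open>A transitive triple has a source, a middle vertex and a sink: the two signs into the
  source, or into the sink, agree, while those into the middle vertex differ, giving 1 - 1 + 1. If
  exactly two vertices coincide, only one product survives, and it is a square.\<close>

lemma arc_sign_cyclic_sum:
  assumes "x \<in> pverts G" "y \<in> pverts G" "z \<in> pverts G"
  shows "arc_sign G y x * arc_sign G z x + arc_sign G z y * arc_sign G x y
    + arc_sign G x z * arc_sign G y z = 1 - of_bool (x = y \<and> x = z)"
proof -
  have *: "(a, c) \<in> parcs G" if "(a, b) \<in> parcs G" "(b, c) \<in> parcs G" for a b c
    using trans_arcs that by (rule transD)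
  have irr: "(a, a) \<notin> parcs G" for a
    using arc_in_verts(3) by blast
  note tot = exactly_one_arc[OF assms(1,2)] exactly_one_arc[OF assms(1,3)]
    exactly_one_arc[OF assms(2,3)]
  show ?thesis
  proof (cases "x \<noteq> y \<and> x \<noteq> z \<and> y \<noteq> z")
    case True
    then have "(y, x) \<in> parcs G \<longleftrightarrow> (x, y) \<notin> parcs G" "(z, x) \<in> parcs G \<longleftrightarrow> (x, z) \<notin> parcs G"
      "(z, y) \<in> parcs G \<longleftrightarrow> (y, z) \<notin> parcs G"
      using tot by blast+
    then show ?thesis
      \<comment> \<open>These two instances of transitivity exclude the two cyclic orientations
        among the eight.\<close>
      using True *[of x y z] *[of x z y]
      by (cases "(x, y) \<in> parcs G"; cases "(x, z) \<in> parcs G"; cases "(y, z) \<in> parcs G")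
        (simp_all add: arc_sign_def)
  next
    case False
    then show ?thesis
      using tot irr by (auto simp: arc_sign_def)
  qed
qed

text \<open>The squares expand to a sum over triples that is invariant under cyclic rotation of the
  indices. Adding the three rotations makes every summand 1, except 0 at the constant
  triples.\<close>

lemma sum_square_arc_sign:
  "3 * (\<Sum>x\<in>pverts G. (\<Sum>y\<in>pverts G. arc_sign G y x)\<^sup>2)
    = int (card (pverts G)) ^ 3 - int (card (pverts G))"
proof -
  let ?V = "pverts G"
  let ?f = "\<lambda>x y z. arc_sign G y x * arc_sign G z x"
  define Q where "Q = (\<Sum>x\<in>?V. \<Sum>y\<in>?V. \<Sum>z\<in>?V. ?f x y z)"
  have "(\<Sum>x\<in>?V. (\<Sum>y\<in>?V. arc_sign G y x)\<^sup>2) = Q"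
    by (simp add: Q_def power2_eq_square sum_product)
  moreover have "Q = (\<Sum>x\<in>?V. \<Sum>y\<in>?V. \<Sum>z\<in>?V. ?f y z x)"
  proof -
    have "Q = (\<Sum>y\<in>?V. \<Sum>x\<in>?V. \<Sum>z\<in>?V. ?f y z x)"
      unfolding Q_def by (rule sum.cong[OF refl], rule sum.swap)
    then show ?thesis
      by (subst (asm) sum.swap)
  qed
  moreover have "Q = (\<Sum>x\<in>?V. \<Sum>y\<in>?V. \<Sum>z\<in>?V. ?f z x y)"
  proof -
    have "Q = (\<Sum>x\<in>?V. \<Sum>z\<in>?V. \<Sum>y\<in>?V. ?f z x y)"
      unfolding Q_def by (rule sum.swap)
    also have "\<dots> = (\<Sum>x\<in>?V. \<Sum>y\<in>?V. \<Sum>z\<in>?V. ?f z x y)"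
      by (rule sum.cong[OF refl], rule sum.swap)
    finally show ?thesis .
  qed
  ultimately have "3 * (\<Sum>x\<in>?V. (\<Sum>y\<in>?V. arc_sign G y x)\<^sup>2)
      = (\<Sum>x\<in>?V. \<Sum>y\<in>?V. \<Sum>z\<in>?V. ?f x y z + ?f y z x + ?f z x y)"
    by (simp add: Q_def sum.distrib)
  also have "\<dots> = (\<Sum>x\<in>?V. \<Sum>y\<in>?V. \<Sum>z\<in>?V. 1 - of_bool (x = y \<and> x = z))"
    by (intro sum.cong refl arc_sign_cyclic_sum)
  also have "\<dots> = (\<Sum>x\<in>?V. \<Sum>y\<in>?V. int (card ?V) - of_bool (x = y))"
    by (intro sum.cong refl) (auto simp: sum_subtractf of_bool_def)
  also have "\<dots> = (\<Sum>x\<in>?V. int (card ?V) * int (card ?V) - 1)"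
    by (intro sum.cong refl) (auto simp: sum_subtractf of_bool_def)
  finally show ?thesis
    by (simp add: power3_eq_cube algebra_simps)
qed

end

section \<open>Orthogonality relations in a doubly regular tournament\<close>

locale doubly_regular_tournament_4m = doubly_regular_tournament +
  fixes m :: nat
  assumes m_pos: "m \<ge> 1"
    and card_verts: "card (pverts G) = 4 * m - 1"
begin

lemma card_verts_int: "int (card (pverts G)) = 4 * int m - 1"
  using m_pos card_verts by simp

lemma sum_out_arcs:
  assumes "x \<in> pverts G"
  shows "(\<Sum>z\<in>pverts G. of_bool ((x, z) \<in> parcs G)) = 2 * int m - 1"
proof -
  have "real (out_degree (with_proj G) x) = real_of_int (2 * int m - 1)"
    using out_degree_eq[OF assms] m_pos card_verts by (simp add: of_nat_diff)
  then have "int (out_degree (with_proj G) x) = 2 * int m - 1"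
    by linarith
  then show ?thesis
    using out_degree_eq_sum[of x] by simp
qed

lemma sum_in_arcs:
  assumes "x \<in> pverts G"
  shows "(\<Sum>z\<in>pverts G. of_bool ((z, x) \<in> parcs G)) = 2 * int m - 1"
proof -
  have "real (in_degree (with_proj G) x) = real_of_int (2 * int m - 1)"
    using in_degree_eq[OF assms] m_pos card_verts by (simp add: of_nat_diff)
  then have "int (in_degree (with_proj G) x) = 2 * int m - 1"
    by linarith
  then show ?thesis
    using in_degree_eq_sum[of x] by simp
qed

text \<open>Double regularity only provides some constant \<open>c\<close>. Counting the triples (x,
  y, z) in which both x and y dominate z, once through the degrees and once through pairs x, y (with
  x = y allowed), determines it.\<close>

lemma sum_common_out_arcs:
  assumes "x \<in> pverts G" "y \<in> pverts G" "x \<noteq> y"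
  shows "(\<Sum>z\<in>pverts G. of_bool ((x, z) \<in> parcs G) * of_bool ((y, z) \<in> parcs G)) = int m - 1"
proof -
  let ?V = "pverts G"
  let ?A = "\<lambda>x y. of_bool ((x, y) \<in> parcs G) :: int"
  obtain c where c: "\<And>x y. x \<in> ?V \<Longrightarrow> y \<in> ?V \<Longrightarrow> x \<noteq> y \<Longrightarrow>
      card {z \<in> ?V. (x, z) \<in> parcs G \<and> (y, z) \<in> parcs G} = c"
    using common_dominated_const by blast
  have common: "(\<Sum>z\<in>?V. ?A x z * ?A y z) = int c" if "x \<in> ?V" "y \<in> ?V" "x \<noteq> y" for x y
    using c[OF that] by (simp add: Int_def flip: of_bool_conj)
  have "(\<Sum>x\<in>?V. \<Sum>y\<in>?V. \<Sum>z\<in>?V. ?A x z * ?A y z) = (\<Sum>x\<in>?V. \<Sum>z\<in>?V. \<Sum>y\<in>?V. ?A x z * ?A y z)"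
    by (rule sum.cong[OF refl], rule sum.swap)
  \<comment> \<open>The sum over y is the in-degree of z; the sum over z that remains is the
    out-degree of x.\<close>
  also have "\<dots> = (\<Sum>x\<in>?V. \<Sum>z\<in>?V. ?A x z * (2 * int m - 1))"
    by (intro sum.cong refl) (simp only: sum_in_arcs flip: sum_distrib_left)
  also have "\<dots> = (\<Sum>x\<in>?V. (2 * int m - 1) * (2 * int m - 1))"
    by (intro sum.cong refl) (simp only: sum_out_arcs flip: sum_distrib_right)
  finally have lhs: "(\<Sum>x\<in>?V. \<Sum>y\<in>?V. \<Sum>z\<in>?V. ?A x z * ?A y z)
      = (4 * int m - 1) * (2 * int m - 1)\<^sup>2"
    by (simp add: card_verts_int power2_eq_square)
  have "(\<Sum>x\<in>?V. \<Sum>y\<in>?V. \<Sum>z\<in>?V. ?A x z * ?A y z)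
      = (\<Sum>x\<in>?V. \<Sum>y\<in>?V. int c + (if x = y then 2 * int m - 1 - int c else 0))"
  proof (intro sum.cong refl)
    fix x y assume "x \<in> ?V" "y \<in> ?V"
    then show "(\<Sum>z\<in>?V. ?A x z * ?A y z)
        = int c + (if x = y then 2 * int m - 1 - int c else 0)"
      using common[of x y] sum_out_arcs[of x] by (cases "x = y") (simp_all flip: of_bool_conj)
  qed
  also have "\<dots> = (\<Sum>x\<in>?V. (4 * int m - 1) * int c + (2 * int m - 1 - int c))"
    by (intro sum.cong refl) (simp add: sum.distrib card_verts_int)
  also have "\<dots> = (4 * int m - 1) * ((4 * int m - 2) * int c + (2 * int m - 1))"
    by (simp add: card_verts_int algebra_simps)
  finally have "(4 * int m - 1) * (2 * int m - 1)\<^sup>2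
      = (4 * int m - 1) * ((4 * int m - 2) * int c + (2 * int m - 1))"
    by (rule trans[OF lhs[symmetric]])
  then have "(2 * int m - 1)\<^sup>2 = (4 * int m - 2) * int c + (2 * int m - 1)"
    using m_pos by simp
  then have "(2 * int m - 1) * (2 * (int m - 1)) = (2 * int m - 1) * (2 * int c)"
    by (simp add: power2_eq_square algebra_simps)
  then have "int c = int m - 1"
    using m_pos by simp
  then show ?thesis
    using common[OF assms] by simp
qed

lemma arc_sign_orthogonal:
  assumes "x \<in> pverts G" "y \<in> pverts G"
  shows "(\<Sum>z\<in>pverts G. arc_sign G x z * arc_sign G y z)
    = (if x = y then 4 * int m - 1 else 0) - 1"
proof -
  let ?V = "pverts G"
  let ?A = "\<lambda>x y. of_bool ((x, y) \<in> parcs G) :: int"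
  \<comment> \<open>Multiplying out two copies of 2A - J + I; the two conditional terms collect the
    contributions of I, each supported on a single z.\<close>
  have "(\<Sum>z\<in>?V. arc_sign G x z * arc_sign G y z)
      = (\<Sum>z\<in>?V. 4 * (?A x z * ?A y z) - 2 * ?A x z - 2 * ?A y z + 1
          + (if y = z then 2 * ?A x z - 1 + of_bool (x = z) else 0)
          + (if x = z then 2 * ?A y z - 1 else 0))"
    using assms by (intro sum.cong refl) (auto simp: arc_sign_eq algebra_simps)
  also have "\<dots> = 4 * (\<Sum>z\<in>?V. ?A x z * ?A y z) - 2 * (\<Sum>z\<in>?V. ?A x z) - 2 * (\<Sum>z\<in>?V. ?A y z)
      + int (card ?V) + (2 * ?A x y - 1 + of_bool (x = y)) + (2 * ?A y x - 1)"
    using assms by (simp add: sum.distrib sum_subtractf flip: sum_distrib_left)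
  finally have expand: "(\<Sum>z\<in>?V. arc_sign G x z * arc_sign G y z)
      = 4 * (\<Sum>z\<in>?V. ?A x z * ?A y z) - 2 * (\<Sum>z\<in>?V. ?A x z) - 2 * (\<Sum>z\<in>?V. ?A y z)
        + int (card ?V) + (2 * ?A x y - 1 + of_bool (x = y)) + (2 * ?A y x - 1)" .
  show ?thesis
  proof (cases "x = y")
    case True
    then show ?thesis
      using expand assms sum_out_arcs[of x] card_verts_int arc_in_verts(3)[of x x]
      by (auto simp flip: of_bool_conj)
  next
    case False
    have "?A x y + ?A y x = 1"
      using exactly_one_arc[OF assms False] by auto
    then show ?thesis
      using expand False sum_common_out_arcs[OF assms False] sum_out_arcs[OF assms(1)]
        sum_out_arcs[OF assms(2)] card_verts_int by simp
  qed
qed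

text \<open>This is the quadratic form of vI - J at the indicator vector of \<open>W\<close>, where
  v = 4m - 1.\<close>

lemma sum_square_arc_sign_subset:
  assumes "W \<subseteq> pverts G"
  shows "(\<Sum>z\<in>pverts G. (\<Sum>x\<in>W. arc_sign G x z)\<^sup>2)
    = int (card W) * (4 * int m - 1 - int (card W))"
proof -
  have fin: "finite W"
    using assms finite_verts by (rule finite_subset)
  have "(\<Sum>z\<in>pverts G. (\<Sum>x\<in>W. arc_sign G x z)\<^sup>2)
      = (\<Sum>z\<in>pverts G. \<Sum>x\<in>W. \<Sum>y\<in>W. arc_sign G x z * arc_sign G y z)"
    by (simp add: power2_eq_square sum_product)
  also have "\<dots> = (\<Sum>x\<in>W. \<Sum>z\<in>pverts G. \<Sum>y\<in>W. arc_sign G x z * arc_sign G y z)"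
    by (rule sum.swap)
  also have "\<dots> = (\<Sum>x\<in>W. \<Sum>y\<in>W. \<Sum>z\<in>pverts G. arc_sign G x z * arc_sign G y z)"
    by (rule sum.cong[OF refl], rule sum.swap)
  also have "\<dots> = (\<Sum>x\<in>W. \<Sum>y\<in>W. (if x = y then 4 * int m - 1 else 0) - 1)"
    using assms by (intro sum.cong refl arc_sign_orthogonal) auto
  also have "\<dots> = (\<Sum>x\<in>W. 4 * int m - 1 - int (card W))"
    using fin by (intro sum.cong refl) (simp add: sum_subtractf)
  finally show ?thesis
    by simp
qed

section \<open>Quadratic inequalities for the size of a transitive subtournament\<close>

lemma transitive_subtournament_sum_square_outside:
  assumes "transitive_subtournament \<Gamma> G"
  defines "s \<equiv> int (card (pverts \<Gamma>))"
  shows "3 * (\<Sum>z\<in>pverts G - pverts \<Gamma>. (\<Sum>x\<in>pverts \<Gamma>. arc_sign G x z)\<^sup>2)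
    = s * (12 * int m - (s + 1) * (s + 2))"
proof -
  let ?W = "pverts \<Gamma>"
  interpret \<Gamma>: transitive_tournament \<Gamma>
    using assms by (simp add: transitive_subtournament_def)
  have ind: "induced_subgraph (with_proj \<Gamma>) (with_proj G)"
    using assms by (simp add: transitive_subtournament_def)
  then have sub: "?W \<subseteq> pverts G"
    by (auto simp: induced_subgraph_def subgraph_def)
  have "parcs \<Gamma> = {e \<in> parcs G. fst e \<in> ?W \<and> snd e \<in> ?W}"
    using ind unfolding induced_subgraph_def with_proj_simps by (rule conjunct2)
  then have parcs: "(x, y) \<in> parcs \<Gamma> \<longleftrightarrow> (x, y) \<in> parcs G" if "x \<in> ?W" "y \<in> ?W" for x y
    using that by (simp only: mem_Collect_eq fst_conv snd_conv simp_thms)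
  \<comment> \<open>As \<Gamma> is induced, signs between its vertices are the same in \<Gamma> and
    in G.\<close>
  have "(\<Sum>z\<in>?W. (\<Sum>x\<in>?W. arc_sign G x z)\<^sup>2) = (\<Sum>z\<in>?W. (\<Sum>x\<in>?W. arc_sign \<Gamma> x z)\<^sup>2)"
    by (simp add: arc_sign_def parcs)
  then have "3 * (\<Sum>z\<in>?W. (\<Sum>x\<in>?W. arc_sign G x z)\<^sup>2) = s ^ 3 - s"
    using \<Gamma>.sum_square_arc_sign by (simp add: s_def)
  moreover have "(\<Sum>z\<in>pverts G. (\<Sum>x\<in>?W. arc_sign G x z)\<^sup>2)
      = (\<Sum>z\<in>pverts G - ?W. (\<Sum>x\<in>?W. arc_sign G x z)\<^sup>2) + (\<Sum>z\<in>?W. (\<Sum>x\<in>?W. arc_sign G x z)\<^sup>2)"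
    using sub by (intro sum.subset_diff) auto
  ultimately show ?thesis
    using sum_square_arc_sign_subset[OF sub]
    by (simp add: s_def power3_eq_cube algebra_simps)
qed

text \<open>The sum of squares over the outer columns is nonnegative, and the factor s can be
  cancelled when s > 0.\<close>

lemma transitive_subtournament_bound:
  assumes "transitive_subtournament \<Gamma> G"
  defines "s \<equiv> int (card (pverts \<Gamma>))"
  shows "(s + 1) * (s + 2) \<le> 12 * int m"
proof (cases "s = 0")
  case True
  then show ?thesis
    using m_pos by simp
next
  case False
  have "0 \<le> s * (12 * int m - (s + 1) * (s + 2))"
    using transitive_subtournament_sum_square_outside[OF assms(1)]
      sum_nonneg[of "pverts G - pverts \<Gamma>" "\<lambda>z. (\<Sum>x\<in>pverts \<Gamma>. arc_sign G x z)\<^sup>2"]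
    by (simp add: s_def)
  moreover have "s > 0"
    using False by (simp add: s_def)
  ultimately show ?thesis
    by (simp add: zero_le_mult_iff)
qed

text \<open>Each outer column sum has s odd terms, so it is odd and its square is at least
  1.\<close>

lemma odd_transitive_subtournament_bound:
  assumes "transitive_subtournament \<Gamma> G"
  defines "s \<equiv> int (card (pverts \<Gamma>))"
  assumes "odd s" "s > 1"
  shows "(s + 1) * (s + 3) \<le> 12 * int m"
proof -
  let ?W = "pverts \<Gamma>"
  have sub: "?W \<subseteq> pverts G"
    using assms(1) by (auto simp: transitive_subtournament_def induced_subgraph_def subgraph_def)
  then have fin: "finite ?W"
    using finite_verts by (rule finite_subset)
  have "1 \<le> (\<Sum>x\<in>?W. arc_sign G x z)\<^sup>2" if z: "z \<in> pverts G - ?W" for z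
  proof -
    have "{x \<in> ?W. odd (arc_sign G x z)} = ?W"
      using z sub odd_arc_sign by auto
    then have "odd (\<Sum>x\<in>?W. arc_sign G x z)"
      using \<open>odd s\<close> fin by (simp add: even_sum_iff s_def)
    then have "(\<Sum>x\<in>?W. arc_sign G x z) \<noteq> 0"
      by (metis even_zero)
    then show ?thesis
      by (simp add: int_one_le_iff_zero_less)
  qed
  then have "(\<Sum>z\<in>pverts G - ?W. 1) \<le> (\<Sum>z\<in>pverts G - ?W. (\<Sum>x\<in>?W. arc_sign G x z)\<^sup>2)"
    by (rule sum_mono)
  moreover have "(\<Sum>z\<in>pverts G - ?W. 1) = 4 * int m - 1 - s"
    using card_verts_int fin sub card_mono[OF finite_verts sub]
    by (simp add: s_def card_Diff_subset of_nat_diff)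
  ultimately have "3 * (4 * int m - 1 - s) \<le> s * (12 * int m - (s + 1) * (s + 2))"
    using transitive_subtournament_sum_square_outside[OF assms(1)] by (simp add: s_def)
  \<comment> \<open>The factor s - 1 comes out because s (s + 2) - 3 = (s - 1) (s + 3).\<close>
  then have "0 \<le> (s - 1) * (12 * int m - (s + 1) * (s + 3))"
    by (simp add: algebra_simps)
  then show ?thesis
    using \<open>s > 1\<close> by (simp add: zero_le_mult_iff)
qed

end

section \<open>From the quadratic inequalities to the floor of the square root\<close>

theorem theorem5p4:
  fixes G \<Gamma> :: "'a pair_pre_digraph" and m s :: nat and \<epsilon> :: real
  assumes "m \<ge> 1"
    and "doubly_regular_tournament G"
    and "card (pverts G) = 4 * m - 1"
    and "transitive_subtournament \<Gamma> G"
    and "card (pverts \<Gamma>) = s"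
    and "\<epsilon> = sqrt (1 + 12 * real m) - real_of_int \<lfloor>sqrt (1 + 12 * real m)\<rfloor>"
  shows "int s \<le> - 1 + \<lfloor>sqrt (1 + 12 * real m)\<rfloor> \<and>
    (\<epsilon> = 0 \<longrightarrow> real s \<le> - 2 + sqrt (1 + 12 * real m)) \<and>
    (\<epsilon> \<noteq> 0 \<and> odd (- 1 + \<lfloor>sqrt (1 + 12 * real m)\<rfloor>) \<longrightarrow>
       int s \<le> - 2 + \<lfloor>sqrt (1 + 12 * real m)\<rfloor>) \<and>
    (\<epsilon> \<noteq> 0 \<and> real_of_int \<lfloor>sqrt (1 + 12 * real m)\<rfloor> > (- 1 + sqrt (1 + 48 * real m)) / 2 \<longrightarrow>
       int s \<le> - 2 + \<lfloor>sqrt (1 + 12 * real m)\<rfloor>)"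
proof -
  interpret doubly_regular_tournament_4m G m
    using assms(1-3) by (simp add: doubly_regular_tournament_4m_def
        doubly_regular_tournament_4m_axioms_def)
  define r where "r = \<lfloor>sqrt (1 + 12 * real m)\<rfloor>"
  \<comment> \<open>Bounds on the floor thus reduce to comparing integer squares with 1 +
    12m.\<close>
  have le_r: "a \<le> r" if "a * a \<le> 1 + 12 * int m" for a :: int
  proof -
    have "real_of_int (a * a) \<le> real_of_int (1 + 12 * int m)"
      using that by (simp only: of_int_le_iff)
    then have "real_of_int a \<le> sqrt (1 + 12 * real m)"
      by (intro real_le_rsqrt) (simp add: power2_eq_square)
    then show ?thesis
      by (simp add: r_def le_floor_iff)
  qed
  have bound: "(int s + 1) * (int s + 2) \<le> 12 * int m"
    using transitive_subtournament_bound[OF assms(4)] assms(5) by simp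
  have 1: "int s \<le> r - 1"
    using le_r[of "int s + 1"] bound by (simp add: algebra_simps)
  have 2: "int s \<le> r - 2" if "12 * int m < r * (r + 1)"
  proof (rule ccontr)
    assume "\<not> int s \<le> r - 2"
    then have "r = int s + 1"
      using 1 by simp
    then show False
      using bound that by (simp add: algebra_simps)
  qed
  have "int s \<le> r - 2" if "\<epsilon> = 0"
  proof -
    have "real_of_int r = sqrt (1 + 12 * real m)"
      using that assms(6) by (simp add: r_def)
    then have "real_of_int (r * r) = real_of_int (1 + 12 * int m)"
      by simp
    then have "r * r = 1 + 12 * int m"
      by (simp only: of_int_eq_iff)
    then show ?thesis
      using 1 2 by (simp add: algebra_simps)
  qed
  moreover have "int s \<le> r - 2" if "odd (r - 1)"
  proof (rule ccontr)
    assume "\<not> int s \<le> r - 2"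
    then have s: "int s = r - 1"
      using 1 by simp
    have "3 \<le> r"
      using le_r[of 3] \<open>m \<ge> 1\<close> by simp
    then have "(int s + 1) * (int s + 3) \<le> 12 * int m"
      using odd_transitive_subtournament_bound[OF assms(4)] assms(5) s that by simp
    then have "int s + 2 \<le> r"
      by (intro le_r) (simp add: algebra_simps)
    then show False
      using s by simp
  qed
  moreover have "int s \<le> r - 2" if "real_of_int r > (- 1 + sqrt (1 + 48 * real m)) / 2"
  proof (rule 2)
    have "sqrt (1 + 48 * real m) < real_of_int (2 * r + 1)"
      using that by simp
    then have "(sqrt (1 + 48 * real m))\<^sup>2 < (real_of_int (2 * r + 1))\<^sup>2"
      by (rule power_strict_mono) simp_all
    then have "real_of_int (1 + 48 * int m) < real_of_int ((2 * r + 1)\<^sup>2)"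
      by simp
    then have "1 + 48 * int m < (2 * r + 1)\<^sup>2"
      by (simp only: of_int_less_iff)
    then show "12 * int m < r * (r + 1)"
      by (simp add: power2_eq_square algebra_simps)
  qed
  moreover have "real s \<le> - 2 + sqrt (1 + 12 * real m)" if "int s \<le> r - 2"
    using that by (simp add: r_def) linarith
  ultimately show ?thesis
    using 1 by (auto simp flip: r_def)
qed

end
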